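(* Let $\mathcal{N}=\{N_\delta:\delta\in\mathcal{D}\}$ be a stopping model. For every statistical model $\mathcal{X}$, each of the four transformations $max_{\mathcal{N}}(max^{-1}_{\mathcal{N}}(\cdot))$, $max^{-1}_{\mathcal{N}}(max_{\mathcal{N}}(\cdot))$, $min_{\mathcal{N}}(min^{-1}_{\mathcal{N}}(\cdot))$ and $min^{-1}_{\mathcal{N}}(min_{\mathcal{N}}(\cdot))$ works as a model extension of $\mathcal{X}$, i.e. $\mathcal{X}$ is contained in the transformed model. This remains true if one of the two new parameters $\delta_1$ or $\delta_2$ is fixed at any value in $\mathcal{D}$ while the other one ranges over $\mathcal{D}$.
   Context: A statistical model $\mathcal{X}=\{X_\theta:\theta\in\Theta\}$ is a family of real random variables, identified with the set of their cumulative distribution functions $F_{X_\theta}$. Models are compared as sets of distributions. A stopping model $\mathcal{N}=\{N_\delta:\delta\in\mathcal{D}\}$, with $\mathcal{D}$ non-empty, is a family of positive integer valued random variables ($\Pr(N_\delta=0)=0$), with probability generating functions (pgfs) $h_{N_\delta}(t)=\sum_{n\ge1}\Pr(N_\delta=n)t^n$, $t\in[0,1]$. Each $h_{N_\delta}$ is an increasing bijection of $[0,1]$ with inverse $h_{N_\delta}^{-1}$, and $\overline{h}_{N_\delta}(t)=1-h_{N_\delta}(1-t)$ is its conjugate, with inverse $\overline{h}_{N_\delta}^{-1}$. The combined transformations are $max_{\mathcal{N}}(max^{-1}_{\mathcal{N}}(\mathcal{X}))=\{Y_{\theta,\delta_1,\delta_2}: F_{Y_{\theta,\delta_1,\delta_2}}=h_{N_{\delta_2}}\circ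 h^{-1}_{N_{\delta_1}}(F_{X_\theta}),\ \theta\in\Theta,\delta_1,\delta_2\in\mathcal{D}\}$, $max^{-1}_{\mathcal{N}}(max_{\mathcal{N}}(\mathcal{X}))=\{Y_{\theta,\delta_1,\delta_2}: F_{Y_{\theta,\delta_1,\delta_2}}=h^{-1}_{N_{\delta_2}}\circ h_{N_{\delta_1}}(F_{X_\theta}),\ \theta\in\Theta,\delta_1,\delta_2\in\mathcal{D}\}$, $min_{\mathcal{N}}(min^{-1}_{\mathcal{N}}(\mathcal{X}))=\{Y_{\theta,\delta_1,\delta_2}: F_{Y_{\theta,\delta_1,\delta_2}}=\overline{h}_{N_{\delta_2}}\circ \overline{h}^{-1}_{N_{\delta_1}}(F_{X_\theta}),\ \theta\in\Theta,\delta_1,\delta_2\in\mathcal{D}\}$, $min^{-1}_{\mathcal{N}}(min_{\mathcal{N}}(\mathcal{X}))=\{Y_{\theta,\delta_1,\delta_2}: F_{Y_{\theta,\delta_1,\delta_2}}=\overline{h}^{-1}_{N_{\delta_2}}\circ \overline{h}_{N_{\delta_1}}(F_{X_\theta}),\ \theta\in\Theta,\delta_1,\delta_2\in\mathcal{D}\}$. A transformation $\mathcal{T}$ works as a model extension of $\mathcal{X}$ if $\mathcal{X}\subseteq\mathcal{T}(\mathcal{X})$ (inclusion not necessarily strict). *)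

theory Defs
  imports "HOL-Probability.Probability"
begin

text \<open>A family of random variables is given by a family of probability spaces and a family of
  random variables on them, so that different members may live on different spaces.\<close>

definition statistical_model ::
  "'t set \<Rightarrow> ('t \<Rightarrow> 'a measure) \<Rightarrow> ('t \<Rightarrow> 'a \<Rightarrow> real) \<Rightarrow> bool" where
  "statistical_model \<Theta> M X \<longleftrightarrow>
     (\<forall>\<theta>\<in>\<Theta>. prob_space (M \<theta>) \<and> X \<theta> \<in> borel_measurable (M \<theta>))"

definition rv_cdf :: "'a measure \<Rightarrow> ('a \<Rightarrow> real) \<Rightarrow> real \<Rightarrow> real" where
  "rv_cdf M X = cdf (distr M borel X)"

definition model_cdfs ::
  "'t set \<Rightarrow> ('t \<Rightarrow> 'a measure) \<Rightarrow> ('t \<Rightarrow> 'a \<Rightarrow> real) \<Rightarrow> (real \<Rightarrow> real) set" where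
  "model_cdfs \<Theta> M X = (\<lambda>\<theta>. rv_cdf (M \<theta>) (X \<theta>)) ` \<Theta>"

definition stopping_model ::
  "'d set \<Rightarrow> ('d \<Rightarrow> 'b measure) \<Rightarrow> ('d \<Rightarrow> 'b \<Rightarrow> nat) \<Rightarrow> bool" where
  "stopping_model D S N \<longleftrightarrow> D \<noteq> {} \<and>
     (\<forall>\<delta>\<in>D. prob_space (S \<delta>) \<and> N \<delta> \<in> measurable (S \<delta>) (count_space UNIV) \<and>
        \<P>(\<omega> in S \<delta>. N \<delta> \<omega> = 0) = 0)"

text \<open>The sum over all positive integers is written with the index shifted by one.\<close>

definition pgf :: "'b measure \<Rightarrow> ('b \<Rightarrow> nat) \<Rightarrow> real \<Rightarrow> real" where
  "pgf S N t = (\<Sum>n. \<P>(\<omega> in S. N \<omega> = Suc n) * t ^ Suc n)"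

definition conj_pgf :: "'b measure \<Rightarrow> ('b \<Rightarrow> nat) \<Rightarrow> real \<Rightarrow> real" where
  "conj_pgf S N t = 1 - pgf S N (1 - t)"

definition pgf_inv :: "'b measure \<Rightarrow> ('b \<Rightarrow> nat) \<Rightarrow> real \<Rightarrow> real" where
  "pgf_inv S N = inv_into {0..1} (pgf S N)"

definition conj_pgf_inv :: "'b measure \<Rightarrow> ('b \<Rightarrow> nat) \<Rightarrow> real \<Rightarrow> real" where
  "conj_pgf_inv S N = inv_into {0..1} (conj_pgf S N)"

definition is_cdf :: "(real \<Rightarrow> real) \<Rightarrow> bool" where
  "is_cdf F \<longleftrightarrow> (\<exists>\<mu>. real_distribution \<mu> \<and> F = cdf \<mu>)"

text \<open>The combined transformations act on models as sets of distribution functions. The two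
  parameters range over separate sets \<open>D1\<close> and \<open>D2\<close>: both are the full parameter set of the
  stopping model in the transformation itself, and one is a singleton when that parameter is
  fixed. The condition \<open>is_cdf G\<close> says that \<open>G\<close> is the distribution function of an actual real
  random variable.\<close>

definition max_max_inv ::
  "('d \<Rightarrow> 'b measure) \<Rightarrow> ('d \<Rightarrow> 'b \<Rightarrow> nat) \<Rightarrow> 'd set \<Rightarrow> 'd set \<Rightarrow>
     (real \<Rightarrow> real) set \<Rightarrow> (real \<Rightarrow> real) set" where
  "max_max_inv S N D1 D2 \<X> =
     {G. is_cdf G \<and> (\<exists>F\<in>\<X>. \<exists>\<delta>1\<in>D1. \<exists>\<delta>2\<in>D2.
           G = pgf (S \<delta>2) (N \<delta>2) \<circ> pgf_inv (S \<delta>1) (N \<delta>1) \<circ> F)}"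

definition max_inv_max ::
  "('d \<Rightarrow> 'b measure) \<Rightarrow> ('d \<Rightarrow> 'b \<Rightarrow> nat) \<Rightarrow> 'd set \<Rightarrow> 'd set \<Rightarrow>
     (real \<Rightarrow> real) set \<Rightarrow> (real \<Rightarrow> real) set" where
  "max_inv_max S N D1 D2 \<X> =
     {G. is_cdf G \<and> (\<exists>F\<in>\<X>. \<exists>\<delta>1\<in>D1. \<exists>\<delta>2\<in>D2.
           G = pgf_inv (S \<delta>2) (N \<delta>2) \<circ> pgf (S \<delta>1) (N \<delta>1) \<circ> F)}"

definition min_min_inv ::
  "('d \<Rightarrow> 'b measure) \<Rightarrow> ('d \<Rightarrow> 'b \<Rightarrow> nat) \<Rightarrow> 'd set \<Rightarrow> 'd set \<Rightarrow>
     (real \<Rightarrow> real) set \<Rightarrow> (real \<Rightarrow> real) set" where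
  "min_min_inv S N D1 D2 \<X> =
     {G. is_cdf G \<and> (\<exists>F\<in>\<X>. \<exists>\<delta>1\<in>D1. \<exists>\<delta>2\<in>D2.
           G = conj_pgf (S \<delta>2) (N \<delta>2) \<circ> conj_pgf_inv (S \<delta>1) (N \<delta>1) \<circ> F)}"

definition min_inv_min ::
  "('d \<Rightarrow> 'b measure) \<Rightarrow> ('d \<Rightarrow> 'b \<Rightarrow> nat) \<Rightarrow> 'd set \<Rightarrow> 'd set \<Rightarrow>
     (real \<Rightarrow> real) set \<Rightarrow> (real \<Rightarrow> real) set" where
  "min_inv_min S N D1 D2 \<X> =
     {G. is_cdf G \<and> (\<exists>F\<in>\<X>. \<exists>\<delta>1\<in>D1. \<exists>\<delta>2\<in>D2.
           G = conj_pgf_inv (S \<delta>2) (N \<delta>2) \<circ> conj_pgf (S \<delta>1) (N \<delta>1) \<circ> F)}"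

definition model_extension ::
  "((real \<Rightarrow> real) set \<Rightarrow> (real \<Rightarrow> real) set) \<Rightarrow> (real \<Rightarrow> real) set \<Rightarrow> bool" where
  "model_extension T \<X> \<longleftrightarrow> \<X> \<subseteq> T \<X>"

end

theory Submission
  imports Defs
begin

text \<open>
  Each transformation sends a distribution function \<open>F\<close> to \<open>f \<circ> g\<^sup>-\<^sup>1 \<circ> F\<close> or
  \<open>g\<^sup>-\<^sup>1 \<circ> f \<circ> F\<close>, where \<open>f\<close> and \<open>g\<close> are generating functions (or conjugates) with
  parameters taken from \<open>D\<close>. On the diagonal \<open>\<delta>1 = \<delta>2\<close> the two functions cancel, so \<open>F\<close>
  itself belongs to the transformed model. A diagonal pair is available both when the
  two parameters range over the non-empty set \<open>D\<close> and when one of them is fixed in \<open>D\<close>.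

  The cancellation needs \<open>f\<close> to be a bijection of \<open>[0,1]\<close>, which contains all values of \<open>F\<close>.
  Since the stopping variable avoids zero almost surely, the coefficients of its
  generating function are non-negative, belong to positive powers only and add up to one.
  Such a power series vanishes at \<open>0\<close>, equals \<open>1\<close> at \<open>1\<close>, is continuous by the Weierstrass
  M-test, and is strictly increasing because some coefficient is positive; the intermediate
  value theorem then gives bijectivity. The conjugate is the generating function
  transported by the reflection \<open>t \<mapsto> 1 - t\<close>, so it inherits bijectivity.
\<close>

lemma sums_prob_eq_Suc:
  fixes N :: "'b \<Rightarrow> nat"
  assumes "prob_space S" and N: "N \<in> measurable S (count_space UNIV)"
    and zero: "\<P>(\<omega> in S. N \<omega> = 0) = 0"
  shows "(\<lambda>n. \<P>(\<omega> in S. N \<omega> = Suc n)) sums 1"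
proof -
  interpret prob_space S by fact
  have meas: "{\<omega> \<in> space S. N \<omega> = n} \<in> sets S" for n
    using measurable_sets[OF N, of "{n}"] by (simp add: vimage_def Int_def conj_commute)
  have "(\<lambda>n. prob {\<omega> \<in> space S. N \<omega> = n}) sums prob (\<Union>n. {\<omega> \<in> space S. N \<omega> = n})"
    by (rule finite_measure_UNION) (use meas in \<open>auto simp: disjoint_family_on_def\<close>)
  moreover have "(\<Union>n. {\<omega> \<in> space S. N \<omega> = n}) = space S"
    by auto
  ultimately have "(\<lambda>n. prob {\<omega> \<in> space S. N \<omega> = n}) sums 1"
    by (simp add: prob_space)
  with zero show ?thesis
    using sums_Suc_iff[of "\<lambda>n. prob {\<omega> \<in> space S. N \<omega> = n}" 1] by simp
qed

lemma strict_mono_bij_betw_unit_interval: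
  fixes f :: "real \<Rightarrow> real"
  assumes "continuous_on {0..1} f" "strict_mono_on {0..1} f" "f 0 = 0" "f 1 = 1"
  shows "bij_betw f {0..1} {0..1}"
proof -
  have "f ` {0..1} \<subseteq> {0..1}"
    using assms(3,4) strict_mono_on_leD[OF assms(2), of 0] strict_mono_on_leD[OF assms(2), of _ 1]
    by fastforce
  moreover have "{0..1} \<subseteq> f ` {0..1}"
    using IVT'[of f 0 _ 1] assms by fastforce
  ultimately show ?thesis
    using strict_mono_on_imp_inj_on[OF assms(2)] by (simp add: bij_betw_def subset_antisym)
qed

text \<open>The coefficients bound the terms of the series on \<open>[0,1]\<close>, so they serve as the
  majorant of the M-test. Starting at the first power forces the value \<open>0\<close> at \<open>0\<close>, and it
  makes every term with a positive coefficient strictly increasing.\<close>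

lemma bij_betw_power_series_of_weights:
  fixes p :: "nat \<Rightarrow> real"
  assumes nonneg: "\<And>n. 0 \<le> p n" and total: "p sums 1"
  shows "bij_betw (\<lambda>t. \<Sum>n. p n * t ^ Suc n) {0..1} {0..1}"
proof (rule strict_mono_bij_betw_unit_interval)
  have bound: "norm (p n * t ^ Suc n) \<le> p n" if "t \<in> {0..1}" for n and t :: real
    using that nonneg[of n] power_le_one[of t "Suc n"]
    by (simp add: abs_mult mult_left_le del: power_Suc)
  have summable: "summable (\<lambda>n. p n * t ^ Suc n)" if "t \<in> {0..1}" for t
    by (rule summable_comparison_test'[OF sums_summable[OF total]]) (rule bound[OF that])
  have "uniform_limit {0..1} (\<lambda>m t. \<Sum>n<m. p n * t ^ Suc n)
      (\<lambda>t. \<Sum>n. p n * t ^ Suc n) sequentially"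
    by (rule Weierstrass_m_test[OF bound sums_summable[OF total]])
  then show "continuous_on {0..1} (\<lambda>t. \<Sum>n. p n * t ^ Suc n)"
    by (rule uniform_limit_theorem[rotated])
      (auto intro!: always_eventually continuous_intros)
  show "strict_mono_on {0..1} (\<lambda>t. \<Sum>n. p n * t ^ Suc n)"
  proof (rule strict_mono_onI)
    fix s t :: real
    assume st: "s \<in> {0..1}" "t \<in> {0..1}" "s < t"
    obtain k where "p k \<noteq> 0"
      using total sums_unique2[of p 1 0] by (metis sums_0 zero_neq_one)
    then have "0 < p k"
      using nonneg[of k] by simp
    have le: "s ^ Suc n \<le> t ^ Suc n" for n
      using st by (intro power_mono) auto
    have less: "s ^ Suc k < t ^ Suc k"
      using st by (intro power_strict_mono) auto
    have "0 < (\<Sum>n. p n * t ^ Suc n - p n * s ^ Suc n)"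
    proof (rule suminf_pos2)
      show "summable (\<lambda>n. p n * t ^ Suc n - p n * s ^ Suc n)"
        by (intro summable_diff summable st)
      show "0 \<le> p n * t ^ Suc n - p n * s ^ Suc n" for n
        using mult_left_mono[OF le nonneg] by (metis diff_ge_0_iff_ge)
      show "0 < p k * t ^ Suc k - p k * s ^ Suc k"
        using mult_strict_left_mono[OF less \<open>0 < p k\<close>] by (metis diff_gt_0_iff_gt)
    qed
    also have "\<dots> = (\<Sum>n. p n * t ^ Suc n) - (\<Sum>n. p n * s ^ Suc n)"
      by (intro suminf_diff[symmetric] summable st)
    finally show "(\<Sum>n. p n * s ^ Suc n) < (\<Sum>n. p n * t ^ Suc n)"
      by simp
  qed
  show "(\<Sum>n. p n * 1 ^ Suc n) = 1"
    using sums_unique[OF total] by simp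
qed simp

lemma bij_betw_pgf:
  assumes "stopping_model D S N" "\<delta> \<in> D"
  shows "bij_betw (pgf (S \<delta>) (N \<delta>)) {0..1} {0..1}"
proof -
  have "(\<lambda>n. \<P>(\<omega> in S \<delta>. N \<delta> \<omega> = Suc n)) sums 1"
    using assms by (intro sums_prob_eq_Suc) (auto simp: stopping_model_def)
  then show ?thesis
    unfolding pgf_def[abs_def] by (rule bij_betw_power_series_of_weights[rotated]) simp
qed

lemma bij_betw_conj_pgf:
  assumes "stopping_model D S N" "\<delta> \<in> D"
  shows "bij_betw (conj_pgf (S \<delta>) (N \<delta>)) {0..1} {0..1}"
proof -
  have reflect: "bij_betw (\<lambda>t::real. 1 - t) {0..1} {0..1}"
    by (rule bij_betw_byWitness[where f' = "\<lambda>t. 1 - t"]) auto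
  have "conj_pgf (S \<delta>) (N \<delta>) = (\<lambda>t. 1 - t) \<circ> (pgf (S \<delta>) (N \<delta>) \<circ> (\<lambda>t. 1 - t))"
    by (simp add: fun_eq_iff conj_pgf_def)
  then show ?thesis
    using bij_betw_trans[OF bij_betw_trans[OF reflect bij_betw_pgf[OF assms]] reflect] by simp
qed

lemma model_cdfs_is_cdf:
  assumes "statistical_model \<Theta> M X" "F \<in> model_cdfs \<Theta> M X"
  shows "is_cdf F"
  using assms prob_space.real_distribution_distr
  unfolding statistical_model_def model_cdfs_def rv_cdf_def is_cdf_def by blast

lemma is_cdf_in_unit_interval:
  assumes "is_cdf F"
  shows "F x \<in> {0..1}"
proof -
  obtain \<mu> where "real_distribution \<mu>" and F: "F = cdf \<mu>"
    using assms by (auto simp: is_cdf_def)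
  then interpret real_distribution \<mu> by simp
  show ?thesis
    using cdf_nonneg[of x] cdf_bounded_prob[of x] by (simp add: F)
qed

text \<open>A diagonal pair of parameters leaves every distribution function unchanged, for
  all four transformations. With separate sets \<open>D1\<close> and \<open>D2\<close> the claims with two free
  parameters and with one fixed parameter become instances of the same fact.\<close>

lemma model_extension_if_common_parameter:
  assumes "stopping_model D S N" "statistical_model \<Theta> M X"
    and "\<delta> \<in> D" "\<delta> \<in> D1" "\<delta> \<in> D2"
    and T: "T \<in> {max_max_inv S N, max_inv_max S N, min_min_inv S N, min_inv_min S N}"
  shows "model_extension (T D1 D2) (model_cdfs \<Theta> M X)"
  unfolding model_extension_def
proof
  fix F assume F: "F \<in> model_cdfs \<Theta> M X"
  have cdf: "is_cdf F"
    using assms(2) F by (rule model_cdfs_is_cdf)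
  have cancel: "F = h \<circ> inv_into {0..1} h \<circ> F" "F = inv_into {0..1} h \<circ> h \<circ> F"
    if "bij_betw h {0..1} {0..1}" for h
    using is_cdf_in_unit_interval[OF cdf] bij_betw_inv_into_right[OF that]
      bij_betw_inv_into_left[OF that] by (simp_all add: fun_eq_iff)
  note pgf = cancel[OF bij_betw_pgf[OF assms(1,3)], folded pgf_inv_def]
  note conj_pgf = cancel[OF bij_betw_conj_pgf[OF assms(1,3)], folded conj_pgf_inv_def]
  from T consider "T = max_max_inv S N" | "T = max_inv_max S N"
    | "T = min_min_inv S N" | "T = min_inv_min S N"
    by blast
  then show "F \<in> T D1 D2 (model_cdfs \<Theta> M X)"
  proof cases
    case 1
    then show ?thesis
      using cdf F assms(4,5) pgf(1) unfolding max_max_inv_def by blast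
  next
    case 2
    then show ?thesis
      using cdf F assms(4,5) pgf(2) unfolding max_inv_max_def by blast
  next
    case 3
    then show ?thesis
      using cdf F assms(4,5) conj_pgf(1) unfolding min_min_inv_def by blast
  next
    case 4
    then show ?thesis
      using cdf F assms(4,5) conj_pgf(2) unfolding min_inv_min_def by blast
  qed
qed

theorem proposition6:
  fixes D :: "'d set" and S :: "'d \<Rightarrow> 'b measure" and N :: "'d \<Rightarrow> 'b \<Rightarrow> nat"
    and \<Theta> :: "'t set" and M :: "'t \<Rightarrow> 'a measure" and X :: "'t \<Rightarrow> 'a \<Rightarrow> real"
  assumes "stopping_model D S N"
    and "statistical_model \<Theta> M X"
  shows "\<forall>T \<in> {max_max_inv S N, max_inv_max S N, min_min_inv S N, min_inv_min S N}.
      model_extension (T D D) (model_cdfs \<Theta> M X) \<and>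
      (\<forall>\<delta>\<in>D. model_extension (T {\<delta>} D) (model_cdfs \<Theta> M X)) \<and>
      (\<forall>\<delta>\<in>D. model_extension (T D {\<delta>}) (model_cdfs \<Theta> M X))"
proof -
  obtain \<delta>0 where "\<delta>0 \<in> D"
    using assms(1) by (auto simp: stopping_model_def)
  then show ?thesis
    by (intro ballI conjI)
      (rule model_extension_if_common_parameter[OF assms]; (assumption | rule singletonI))+
qed

end
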